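(* Let $\kappa\geq\omega$ be a regular cardinal and let $\mathbb P=\langle P,\leq\rangle$ be a $<\!\kappa$-directed poset of size $\kappa$ with a root $r$, such that $\mathrm{Is}(r)\setminus(\cdot,p]\neq\emptyset$ for all $p\in P$, some $a_0\in\mathrm{Is}(r)$ has an immediate successor, and $$\forall a,p\in P\ \ \exists\eta\in\mathrm{Pc}(\mathbb P)\ \ \eta:(\cdot,a]\to[p,\cdot).$$ Then $\mathbb P$ is not reversible.
   Context: A poset $\mathbb P=\langle P,\leq\rangle$ is reversible iff each bijection $f:P\to P$ with $x\leq y\Rightarrow f(x)\leq f(y)$ for all $x,y$ is an automorphism. $\mathbb P$ is $<\!\kappa$-directed iff each $S\subset P$ of size $<\kappa$ has an upper bound. The root of $\mathbb P$ is its least element. An element $q$ is an immediate successor of $p$, written $q\in\mathrm{Is}(p)$, iff $p<q$ and there is no $s\in P$ with $p<s<q$. $(\cdot,p]=\{q\in P:q\leq p\}$ and $[p,\cdot)=\{q\in P:p\leq q\}$. $\mathrm{Pc}(\mathbb P)$ is the set of partial condensations of $\mathbb P$: bijections $\eta$ from a set $\mathrm{dom}(\eta)\subset P$ onto a set $\mathrm{ran}(\eta)\subset P$ with $x\leq y\Rightarrow\eta(x)\leq\eta(y)$ for all $x,y\in\mathrm{dom}(\eta)$. The notation $\eta:(\cdot,a]\to[p,\cdot)$ means $\mathrm{dom}(\eta)=(\cdot,a]$ and $\mathrm{ran}(\eta)\subset[p,\cdot)$. *)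

theory Defs
  imports Main
begin

unbundle cardinal_syntax

text \<open>
  A poset is a carrier \<open>P\<close> with a relation \<open>le\<close> such that \<^term>\<open>partial_order_on P le\<close>; this
  includes \<^prop>\<open>le \<subseteq> P \<times> P\<close>, so that the library's \<^term>\<open>under le a\<close> and \<^term>\<open>above le p\<close> are
  the sets $(\cdot,a]$ and $[p,\cdot)$ of the poset.
\<close>

definition condensation_on :: "'a set \<Rightarrow> 'a rel \<Rightarrow> ('a \<Rightarrow> 'a) \<Rightarrow> bool" where
  "condensation_on P le f \<longleftrightarrow>
     bij_betw f P P \<and> (\<forall>x\<in>P. \<forall>y\<in>P. (x, y) \<in> le \<longrightarrow> (f x, f y) \<in> le)"

definition automorphism_on :: "'a set \<Rightarrow> 'a rel \<Rightarrow> ('a \<Rightarrow> 'a) \<Rightarrow> bool" where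
  "automorphism_on P le f \<longleftrightarrow>
     bij_betw f P P \<and> (\<forall>x\<in>P. \<forall>y\<in>P. (x, y) \<in> le \<longleftrightarrow> (f x, f y) \<in> le)"

definition reversible :: "'a set \<Rightarrow> 'a rel \<Rightarrow> bool" where
  "reversible P le \<longleftrightarrow> (\<forall>f. condensation_on P le f \<longrightarrow> automorphism_on P le f)"

definition directed_below :: "'k rel \<Rightarrow> 'a set \<Rightarrow> 'a rel \<Rightarrow> bool" where
  "directed_below \<kappa> P le \<longleftrightarrow> (\<forall>S. S \<subseteq> P \<and> |S| <o \<kappa> \<longrightarrow> (\<exists>u\<in>P. \<forall>x\<in>S. (x, u) \<in> le))"

definition is_root :: "'a set \<Rightarrow> 'a rel \<Rightarrow> 'a \<Rightarrow> bool" where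
  "is_root P le r \<longleftrightarrow> r \<in> P \<and> (\<forall>x\<in>P. (r, x) \<in> le)"

definition strictly_below :: "'a rel \<Rightarrow> 'a \<Rightarrow> 'a \<Rightarrow> bool" where
  "strictly_below le x y \<longleftrightarrow> (x, y) \<in> le \<and> x \<noteq> y"

definition Is :: "'a set \<Rightarrow> 'a rel \<Rightarrow> 'a \<Rightarrow> 'a set" where
  "Is P le p = {q \<in> P. strictly_below le p q \<and>
     \<not> (\<exists>s\<in>P. strictly_below le p s \<and> strictly_below le s q)}"

text \<open>
  A partial condensation is a partial map \<open>\<eta>\<close>; being a bijection of \<^term>\<open>dom \<eta>\<close> onto
  \<^term>\<open>ran \<eta>\<close> is injectivity on \<^term>\<open>dom \<eta>\<close>.
\<close>

definition Pc :: "'a set \<Rightarrow> 'a rel \<Rightarrow> ('a \<rightharpoonup> 'a) set" where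
  "Pc P le = {\<eta>. dom \<eta> \<subseteq> P \<and> ran \<eta> \<subseteq> P \<and> inj_on \<eta> (dom \<eta>) \<and>
     (\<forall>x\<in>dom \<eta>. \<forall>y\<in>dom \<eta>. (x, y) \<in> le \<longrightarrow> (the (\<eta> x), the (\<eta> y)) \<in> le)}"

end

theory Submission
  imports Defs
begin

text \<open>
  A condensation of \<open>P\<close> is built by a back-and-forth recursion of length \<open>\<kappa>\<close>, the approximations
  being partial condensations whose domain is a bounded down-set and whose range is bounded. A new
  element \<open>y\<close> enters the range as the image of an immediate successor of the root lying outside the
  current domain; only the root is below such an element, so monotonicity is free. New elements of
  the domain are sent, by one of the given maps \<open>\<eta>\<close>, above everything in the current range;
  they are never below old elements, since the old domain is a down-set. Directedness bounds the
  unions at limit stages. Starting with some immediate successor of the root mapped to an element that is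
  not one, the resulting condensation fixes the root and is no automorphism.
\<close>

section \<open>Approximations as relations, and their unions\<close>

text \<open>A relation instead of a partial map turns extensions into insertions and limits into
  unions. The equivalence of \<open>x = x'\<close> and \<open>y = y'\<close> expresses
  single-valuedness and injectivity together.\<close>

definition down_condensation :: "'a set \<Rightarrow> 'a rel \<Rightarrow> 'a \<Rightarrow> 'a rel \<Rightarrow> bool" where
  "down_condensation P le r g \<longleftrightarrow>
     g \<subseteq> P \<times> P \<and> (r, r) \<in> g \<and>
     (\<forall>x\<in>Domain g. under le x \<subseteq> Domain g) \<and>
     (\<forall>x y x' y'. (x, y) \<in> g \<longrightarrow> (x', y') \<in> g \<longrightarrow>
        (x = x' \<longleftrightarrow> y = y') \<and> ((x, x') \<in> le \<longrightarrow> (y, y') \<in> le))"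

text \<open>Kept apart from \<open>down_condensation\<close> because the relation reached at the end
  has domain and range \<open>P\<close>, and a bound for it would be a largest element, which the
  assumption \<open>fresh\<close> below excludes.\<close>

definition bounded_rel :: "'a set \<Rightarrow> 'a rel \<Rightarrow> 'a rel \<Rightarrow> bool" where
  "bounded_rel P le g \<longleftrightarrow>
     (\<exists>a\<in>P. Domain g \<subseteq> under le a) \<and> (\<exists>p\<in>P. Range g \<subseteq> under le p)"

lemma down_condensationI:
  assumes "g \<subseteq> P \<times> P" "(r, r) \<in> g" "\<And>x. x \<in> Domain g \<Longrightarrow> under le x \<subseteq> Domain g"
    and "\<And>x y x' y'. (x, y) \<in> g \<Longrightarrow> (x', y') \<in> g \<Longrightarrow>
      (x = x' \<longleftrightarrow> y = y') \<and> ((x, x') \<in> le \<longrightarrow> (y, y') \<in> le)"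
  shows "down_condensation P le r g"
  unfolding down_condensation_def
proof (rule conjI[OF assms(1) conjI[OF assms(2) conjI]])
qed (intro ballI allI impI assms(3,4); assumption)+

lemma down_condensationD:
  assumes "down_condensation P le r g"
  shows "g \<subseteq> P \<times> P" "(r, r) \<in> g" "\<And>x. x \<in> Domain g \<Longrightarrow> under le x \<subseteq> Domain g"
    and "\<And>x y x' y'. (x, y) \<in> g \<Longrightarrow> (x', y') \<in> g \<Longrightarrow>
      (x = x' \<longleftrightarrow> y = y') \<and> ((x, x') \<in> le \<longrightarrow> (y, y') \<in> le)"
proof -
  note d = assms[unfolded down_condensation_def]
  show "g \<subseteq> P \<times> P" "(r, r) \<in> g"
    using d by simp_all
  show "under le x \<subseteq> Domain g" if "x \<in> Domain g" for x
    using d[THEN conjunct2, THEN conjunct2, THEN conjunct1] that by (rule bspec)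
  show "(x = x' \<longleftrightarrow> y = y') \<and> ((x, x') \<in> le \<longrightarrow> (y, y') \<in> le)"
    if "(x, y) \<in> g" "(x', y') \<in> g" for x y x' y'
    using d[THEN conjunct2, THEN conjunct2, THEN conjunct2, rule_format, OF that] by blast
qed

text \<open>The conditions involve at most two pairs at a time, and in a chain any two pairs lie in
  a common member.\<close>

lemma down_condensation_Union:
  assumes "C \<noteq> {}"
    and dc: "\<And>g. g \<in> C \<Longrightarrow> down_condensation P le r g"
    and chain: "\<And>g h. g \<in> C \<Longrightarrow> h \<in> C \<Longrightarrow> g \<subseteq> h \<or> h \<subseteq> g"
  shows "down_condensation P le r (\<Union>C)"
proof -
  have "(x = x' \<longleftrightarrow> y = y') \<and> ((x, x') \<in> le \<longrightarrow> (y, y') \<in> le)"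
    if "(x, y) \<in> \<Union>C" "(x', y') \<in> \<Union>C" for x y x' y'
  proof -
    obtain g where "g \<in> C" "(x, y) \<in> g" "(x', y') \<in> g"
      using \<open>(x, y) \<in> \<Union>C\<close> \<open>(x', y') \<in> \<Union>C\<close> chain by (meson UnionE subsetD)
    then show ?thesis using down_condensationD(4)[OF dc[of g]] by blast
  qed
  moreover have "\<Union>C \<subseteq> P \<times> P"
    using down_condensationD(1)[OF dc] by blast
  moreover have "under le x \<subseteq> Domain (\<Union>C)" if "x \<in> Domain (\<Union>C)" for x
    using that down_condensationD(3)[OF dc] by blast
  moreover have "(r, r) \<in> \<Union>C"
    using \<open>C \<noteq> {}\<close> down_condensationD(2)[OF dc] by blast
  ultimately show ?thesis
    by (intro down_condensationI)
qed

text \<open>Choose one bound for each index: these are fewer than \<open>\<kappa>\<close> elements,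
  so directedness bounds the bounds themselves.\<close>

lemma bounded_rel_UN:
  assumes dir: "directed_below \<kappa> P le" and "trans le" and small: "|I| <o \<kappa>"
    and bd: "\<And>i. i \<in> I \<Longrightarrow> bounded_rel P le (G i)"
  shows "bounded_rel P le (\<Union>i\<in>I. G i)"
proof -
  have ub: "\<exists>u\<in>P. \<forall>i\<in>I. (f i, u) \<in> le" if "\<And>i. i \<in> I \<Longrightarrow> f i \<in> P" for f
  proof -
    have "|f ` I| <o \<kappa>"
      using card_of_image small by (rule ordLeq_ordLess_trans)
    moreover have "f ` I \<subseteq> P"
      using that by blast
    ultimately have "\<exists>u\<in>P. \<forall>x\<in>f ` I. (x, u) \<in> le"
      using dir[unfolded directed_below_def, rule_format, of "f ` I"] by simp
    then show ?thesis by simp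
  qed
  have "\<forall>i\<in>I. \<exists>a. a \<in> P \<and> Domain (G i) \<subseteq> under le a"
    "\<forall>i\<in>I. \<exists>p. p \<in> P \<and> Range (G i) \<subseteq> under le p"
    using bd unfolding bounded_rel_def by blast+
  then obtain a p where a: "\<And>i. i \<in> I \<Longrightarrow> a i \<in> P \<and> Domain (G i) \<subseteq> under le (a i)"
    and p: "\<And>i. i \<in> I \<Longrightarrow> p i \<in> P \<and> Range (G i) \<subseteq> under le (p i)"
    by metis
  obtain u v where u: "u \<in> P" "\<forall>i\<in>I. (a i, u) \<in> le" and v: "v \<in> P" "\<forall>i\<in>I. (p i, v) \<in> le"
    using ub[of a] ub[of p] a p by blast
  have "Domain (\<Union>i\<in>I. G i) \<subseteq> under le u"
    using a u(2) under_incr[OF \<open>trans le\<close>] by blast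
  moreover have "Range (\<Union>i\<in>I. G i) \<subseteq> under le v"
    using p v(2) under_incr[OF \<open>trans le\<close>] by blast
  ultimately show ?thesis
    using u(1) v(1) unfolding bounded_rel_def by blast
qed

section \<open>One-step extensions of an approximation\<close>

lemma IsD:
  assumes "x \<in> Is P le r"
  shows "x \<in> P" "(r, x) \<in> le" "x \<noteq> r"
    and "\<And>z. is_root P le r \<Longrightarrow> z \<in> P \<Longrightarrow> (z, x) \<in> le \<Longrightarrow> z = r \<or> z = x"
  using assms unfolding Is_def strictly_below_def is_root_def by blast+

text \<open>That \<open>x\<close> is an immediate successor of the root serves twice: it makes
  monotonicity free here, and it is recorded in the conclusion because the main theorem needs it for
  its starting pair.\<close>

lemma extend_range:
  assumes po: "partial_order_on P le"
    and up: "\<And>u v. u \<in> P \<Longrightarrow> v \<in> P \<Longrightarrow> \<exists>w\<in>P. (u, w) \<in> le \<and> (v, w) \<in> le"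
    and root: "is_root P le r"
    and fresh: "\<forall>p\<in>P. Is P le r - under le p \<noteq> {}"
    and g: "down_condensation P le r g" and bd: "bounded_rel P le g"
    and y: "y \<in> P" "y \<notin> Range g"
  shows "\<exists>x\<in>Is P le r. down_condensation P le r (insert (x, y) g) \<and>
           bounded_rel P le (insert (x, y) g)"
proof -
  have le: "le \<subseteq> P \<times> P" and tr: "trans le" and refl: "\<And>x. x \<in> P \<Longrightarrow> (x, x) \<in> le"
    using po unfolding partial_order_on_def preorder_on_def refl_on_def by blast+
  obtain a p where a: "a \<in> P" "Domain g \<subseteq> under le a" and p: "p \<in> P" "Range g \<subseteq> under le p"
    using bd unfolding bounded_rel_def by blast
  obtain x where x: "x \<in> Is P le r" "x \<notin> under le a"
    using fresh a(1) by blast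
  note xD = IsD[OF x(1)]
  note sub = down_condensationD(1)[OF g] and rr = down_condensationD(2)[OF g]
    and down = down_condensationD(3)[OF g] and pair = down_condensationD(4)[OF g]
  have xg: "x \<notin> Domain g"
    using x(2) a(2) by blast
  \<comment> \<open>The domain is a down-set, so an old point above \<open>x\<close> would force
    \<open>x\<close> to be old.\<close>
  have up_x: "(x, z) \<notin> le" if "z \<in> Domain g" for z
    using down[OF that] xg unfolding under_def by blast
  have below: "z = r \<or> z = x" if "(z, x) \<in> le" for z
    using xD(4)[OF root _ that] that le by blast
  have ry: "(r, y) \<in> le"
    using root y(1) unfolding is_root_def by blast
  \<comment> \<open>The only old point below \<open>x\<close> is \<open>r\<close>. As its value is
    \<open>r\<close>, the required relation is \<open>(r, y) \<in> le\<close>.\<close>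
  have rv: "v = r" if "(r, v) \<in> g" for v
    using pair[OF that rr] by blast
  have "under le z \<subseteq> Domain (insert (x, y) g)" if "z \<in> Domain (insert (x, y) g)" for z
    using that down below rr unfolding under_def by blast
  moreover have "(u = u' \<longleftrightarrow> v = v') \<and> ((u, u') \<in> le \<longrightarrow> (v, v') \<in> le)"
    if "(u, v) \<in> insert (x, y) g" "(u', v') \<in> insert (x, y) g" for u v u' v'
    using that pair[of u v u' v'] up_x[of u] up_x[of u'] below[of u] xg y(2) ry refl[OF y(1)] rv
    by blast
  moreover have "insert (x, y) g \<subseteq> P \<times> P" "(r, r) \<in> insert (x, y) g"
    using sub rr xD(1) y(1) by blast+
  ultimately have "down_condensation P le r (insert (x, y) g)"
    by (intro down_condensationI)
  moreover have "bounded_rel P le (insert (x, y) g)"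
  proof -
    obtain a' p' where "a' \<in> P" "(a, a') \<in> le" "(x, a') \<in> le"
      and "p' \<in> P" "(p, p') \<in> le" "(y, p') \<in> le"
      using up[OF a(1) xD(1)] up[OF p(1) y(1)] by blast
    moreover have "Domain (insert (x, y) g) \<subseteq> under le a'"
      using a(2) under_incr[OF tr \<open>(a, a') \<in> le\<close>] \<open>(x, a') \<in> le\<close> by (auto simp: under_def)
    moreover have "Range (insert (x, y) g) \<subseteq> under le p'"
      using p(2) under_incr[OF tr \<open>(p, p') \<in> le\<close>] \<open>(y, p') \<in> le\<close> by (auto simp: under_def)
    ultimately show ?thesis
      unfolding bounded_rel_def by blast
  qed
  ultimately show ?thesis
    using x(1) by blast
qed

text \<open>A whole principal down-set containing the old domain and \<open>x\<close> becomes the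
  new domain, which keeps it closed downwards; \<open>\<eta>\<close> is used only at the points not
  yet in the domain.\<close>

lemma extend_domain:
  assumes po: "partial_order_on P le"
    and up: "\<And>u v. u \<in> P \<Longrightarrow> v \<in> P \<Longrightarrow> \<exists>w\<in>P. (u, w) \<in> le \<and> (v, w) \<in> le"
    and fresh: "\<forall>p\<in>P. Is P le r - under le p \<noteq> {}"
    and emb: "\<forall>a\<in>P. \<forall>p\<in>P. \<exists>\<eta>\<in>Pc P le. dom \<eta> = under le a \<and> ran \<eta> \<subseteq> above le p"
    and g: "down_condensation P le r g" and bd: "bounded_rel P le g"
    and x: "x \<in> P"
  shows "\<exists>h. g \<subseteq> h \<and> x \<in> Domain h \<and> down_condensation P le r h \<and> bounded_rel P le h"
proof -
  have le: "le \<subseteq> P \<times> P" and tr: "trans le"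
    and refl: "\<And>x. x \<in> P \<Longrightarrow> (x, x) \<in> le"
    using po unfolding partial_order_on_def preorder_on_def refl_on_def by blast+
  obtain a\<^sub>1 p\<^sub>1 where a\<^sub>1: "a\<^sub>1 \<in> P" "Domain g \<subseteq> under le a\<^sub>1"
    and p\<^sub>1: "p\<^sub>1 \<in> P" "Range g \<subseteq> under le p\<^sub>1"
    using bd unfolding bounded_rel_def by blast
  obtain a where a: "a \<in> P" "(a\<^sub>1, a) \<in> le" "(x, a) \<in> le"
    using up[OF a\<^sub>1(1) x] by blast
  \<comment> \<open>The role of \<open>c\<close> is to push \<open>p\<close> strictly above
    \<open>p\<^sub>1\<close>: as \<open>c\<close> is below \<open>p\<close> but not below
    \<open>p\<^sub>1\<close>, neither is \<open>p\<close>. Values above \<open>p\<close> then cannot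
    meet the old range.\<close>
  obtain c where "c \<in> Is P le r" "c \<notin> under le p\<^sub>1"
    using fresh p\<^sub>1(1) by blast
  then have c: "c \<in> P" "(c, p\<^sub>1) \<notin> le"
    by (auto simp: under_def dest: IsD(1))
  obtain p where p: "p \<in> P" "(p\<^sub>1, p) \<in> le" "(c, p) \<in> le"
    using up[OF p\<^sub>1(1) c(1)] by blast
  have "(p, p\<^sub>1) \<notin> le"
    using c(2) transD[OF tr p(3)] by blast
  obtain \<eta> where "\<eta> \<in> Pc P le" and dom\<eta>: "dom \<eta> = under le a" and ran\<eta>: "ran \<eta> \<subseteq> above le p"
    using emb a(1) p(1) by blast
  then have inj\<eta>: "inj_on \<eta> (under le a)" and mono\<eta>:
    "\<And>x y. x \<in> under le a \<Longrightarrow> y \<in> under le a \<Longrightarrow> (x, y) \<in> le \<Longrightarrow> (the (\<eta> x), the (\<eta> y)) \<in> le"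
    unfolding Pc_def by auto
  \<comment> \<open>A total version of \<open>\<eta>\<close>; its arbitrary values outside
    \<open>under le a\<close> never enter.\<close>
  define e where "e u = the (\<eta> u)" for u
  have some: "\<eta> u = Some (e u)" if "u \<in> under le a" for u
  proof -
    have "u \<in> dom \<eta>"
      using that by (simp only: dom\<eta>)
    then show ?thesis
      unfolding e_def by auto
  qed
  have e_above: "(p, e u) \<in> le" if "u \<in> under le a" for u
  proof -
    have "e u \<in> ran \<eta>"
      using some[OF that] by (rule ranI)
    then show ?thesis
      using ran\<eta> unfolding above_def by blast
  qed
  have e_inj: "u = u'" if "u \<in> under le a" "u' \<in> under le a" "e u = e u'" for u u'
    using inj_onD[OF inj\<eta>] some that by metis
  have e_mono: "(e u, e u') \<in> le" if "u \<in> under le a" "u' \<in> under le a" "(u, u') \<in> le" for u u'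
    using mono\<eta> that unfolding e_def by blast
  note sub = down_condensationD(1)[OF g] and rr = down_condensationD(2)[OF g]
    and down = down_condensationD(3)[OF g] and pair = down_condensationD(4)[OF g]
  define N where "N = under le a - Domain g"
  define h where "h = g \<union> (\<lambda>u. (u, e u)) ` N"
  have "Domain g \<subseteq> under le a"
    using a\<^sub>1(2) under_incr[OF tr a(2)] by blast
  then have Dh: "Domain h = under le a"
    unfolding h_def N_def by auto
  \<comment> \<open>Here \<open>v\<close> is below \<open>p\<^sub>1\<close>, then \<open>p\<close>,
    then \<open>e u\<close>; equality would put \<open>p\<close> below \<open>p\<^sub>1\<close>. The
    relation holds whether or not the arguments are comparable.\<close>
  have old_new: "(v, e u) \<in> le \<and> v \<noteq> e u" if "v \<in> Range g" "u \<in> under le a" for u v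
  proof -
    have "(v, p\<^sub>1) \<in> le" "(p, e u) \<in> le"
      using that p\<^sub>1(2) e_above unfolding under_def by blast+
    then show ?thesis
      using p(2) \<open>(p, p\<^sub>1) \<notin> le\<close> transD[OF tr] by metis
  qed
  have ag: "a \<in> under le a"
    using refl a(1) unfolding under_def by blast
  have "h \<subseteq> P \<times> P"
    using sub e_above le unfolding h_def N_def under_def by blast
  moreover have "under le z \<subseteq> Domain h" if "z \<in> Domain h" for z
    using that transD[OF tr] unfolding Dh under_def by blast
  moreover have "(u = u' \<longleftrightarrow> v = v') \<and> ((u, u') \<in> le \<longrightarrow> (v, v') \<in> le)"
    if uv: "(u, v) \<in> h" and uv': "(u', v') \<in> h" for u v u' v'
  proof -
    have cases: "(w, z) \<in> g \<or> w \<in> under le a \<and> w \<notin> Domain g \<and> z = e w" if "(w, z) \<in> h" for w z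
      using that unfolding h_def N_def by blast
    have not_below: "(w, w') \<notin> le" if "w \<notin> Domain g" "w' \<in> Domain g" for w w'
      using that down unfolding under_def by blast
    from cases[OF uv] cases[OF uv'] show ?thesis
    proof (elim disjE conjE)
      assume "(u, v) \<in> g" "(u', v') \<in> g"
      then show ?thesis by (rule pair)
    next
      assume *: "(u, v) \<in> g" "u' \<in> under le a" "u' \<notin> Domain g" "v' = e u'"
      then show ?thesis using old_new[of v u'] by blast
    \<comment> \<open>New against old: the down-set property rules out \<open>u\<close> below
      \<open>u'\<close>, so only distinctness of the values is at stake.\<close>
    next
      assume *: "(u', v') \<in> g" "u \<in> under le a" "u \<notin> Domain g" "v = e u"
      then show ?thesis using old_new[of v' u] not_below[of u u'] by blast
    next
      assume "u \<in> under le a" "v = e u" "u' \<in> under le a" "v' = e u'"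
      then show ?thesis using e_inj[of u u'] e_mono[of u u'] by blast
    qed
  qed
  moreover have "(r, r) \<in> h"
    using rr unfolding h_def by blast
  ultimately have "down_condensation P le r h"
    by (intro down_condensationI)
  moreover have "bounded_rel P le h"
  proof -
    \<comment> \<open>The top \<open>a\<close> of the new domain supplies the bound
      \<open>e a\<close> for the new values. It bounds the old values by \<open>old_new\<close>,
      even if \<open>a\<close> is an old point.\<close>
    have "(e u, e a) \<in> le" if "u \<in> N" for u
      using that e_mono[OF _ ag] unfolding N_def under_def by blast
    then have "Range h \<subseteq> under le (e a)"
      using old_new[OF _ ag] unfolding h_def under_def by blast
    moreover have "e a \<in> P"
      using e_above[OF ag] le by blast
    ultimately show ?thesis
      using a(1) Dh unfolding bounded_rel_def by blast
  qed
  moreover have "x \<in> Domain h"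
    using a(3) unfolding Dh under_def by simp
  moreover have "g \<subseteq> h"
    unfolding h_def by blast
  ultimately show ?thesis
    by blast
qed

text \<open>Putting the same element into domain and range at one stage lets a recursion indexed by
  \<open>P\<close> itself exhaust both sides.\<close>

lemma extend_both:
  assumes po: "partial_order_on P le"
    and up: "\<And>u v. u \<in> P \<Longrightarrow> v \<in> P \<Longrightarrow> \<exists>w\<in>P. (u, w) \<in> le \<and> (v, w) \<in> le"
    and root: "is_root P le r"
    and fresh: "\<forall>p\<in>P. Is P le r - under le p \<noteq> {}"
    and emb: "\<forall>a\<in>P. \<forall>p\<in>P. \<exists>\<eta>\<in>Pc P le. dom \<eta> = under le a \<and> ran \<eta> \<subseteq> above le p"
    and g: "down_condensation P le r g" and bd: "bounded_rel P le g"
    and x: "x \<in> P"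
  shows "\<exists>h. g \<subseteq> h \<and> x \<in> Domain h \<and> x \<in> Range h \<and>
           down_condensation P le r h \<and> bounded_rel P le h"
proof -
  obtain g' where g': "g \<subseteq> g'" "x \<in> Range g'" "down_condensation P le r g'" "bounded_rel P le g'"
  proof (cases "x \<in> Range g")
    case True
    then show ?thesis using that g bd by blast
  next
    case False
    then show ?thesis
      using that extend_range[OF po up root fresh g bd x] by blast
  qed
  obtain h where "g' \<subseteq> h" "x \<in> Domain h" "down_condensation P le r h" "bounded_rel P le h"
    using extend_domain[OF po up fresh emb g'(3,4) x] by blast
  with g'(1,2) show ?thesis by blast
qed

section \<open>Transfinite recursion to a condensation of the whole poset\<close>

lemma total_down_condensation:
  assumes g: "down_condensation P le r g" and "Domain g = P" "Range g = P"
  obtains f where "condensation_on P le f" "\<And>x y. (x, y) \<in> g \<Longrightarrow> f x = y"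
proof -
  note pair = down_condensationD(4)[OF g]
  have "\<forall>x\<in>P. \<exists>y. (x, y) \<in> g"
    using \<open>Domain g = P\<close> by blast
  then obtain f where f: "\<And>x. x \<in> P \<Longrightarrow> (x, f x) \<in> g"
    by metis
  have fun_eq: "f x = y" if "(x, y) \<in> g" for x y
    using pair[OF that f] that \<open>Domain g = P\<close> by blast
  have "inj_on f P"
    using pair f by (meson inj_onI)
  moreover have "f ` P = P"
  proof
    show "f ` P \<subseteq> P"
      using RangeI[OF f] \<open>Range g = P\<close> by blast
    show "P \<subseteq> f ` P"
    proof
      fix y assume "y \<in> P"
      then obtain x where "(x, y) \<in> g"
        using \<open>Range g = P\<close> by blast
      moreover from this have "x \<in> P"
        using \<open>Domain g = P\<close> by blast
      ultimately show "y \<in> f ` P"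
        using fun_eq by blast
    qed
  qed
  ultimately have "condensation_on P le f"
    using pair[OF f f] unfolding condensation_on_def bij_betw_def by blast
  with fun_eq that show thesis by blast
qed

text \<open>The recursion runs along the cardinal well-order of \<open>P\<close>, whose proper
  initial segments have size below \<open>\<kappa>\<close>; hence the union of all earlier
  approximations is still bounded and can be extended.\<close>

lemma exhaust_by_extension:
  fixes P :: "'a set"
  assumes po: "partial_order_on P le"
    and dir: "directed_below \<kappa> P le" and card: "|P| =o \<kappa>"
    and root: "is_root P le r"
    and fresh: "\<forall>p\<in>P. Is P le r - under le p \<noteq> {}"
    and emb: "\<forall>a\<in>P. \<forall>p\<in>P. \<exists>\<eta>\<in>Pc P le. dom \<eta> = under le a \<and> ran \<eta> \<subseteq> above le p"
    and up: "\<And>u v. u \<in> P \<Longrightarrow> v \<in> P \<Longrightarrow> \<exists>w\<in>P. (u, w) \<in> le \<and> (v, w) \<in> le"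
    and g: "down_condensation P le r g" and bd: "bounded_rel P le g"
  obtains h where "g \<subseteq> h" "down_condensation P le r h" "Domain h = P" "Range h = P"
proof -
  have tr: "trans le"
    using po unfolding partial_order_on_def preorder_on_def by blast
  have wo: "Well_order |P|" and Field: "Field |P| = P"
    by (rule card_of_Well_order, rule Field_card_of)
  define R where "R = |P| - Id"
  have "wf R"
    using wo unfolding R_def well_order_on_def by blast
  have "trans |P|" "antisym |P|"
    using wo unfolding well_order_on_def linear_order_on_def partial_order_on_def preorder_on_def
    by blast+
  then have trR: "(x, z) \<in> R" if "(x, y) \<in> R" "(y, z) \<in> R" for x y z
    using that unfolding R_def by (blast dest: transD antisymD)
  have totR: "x = y \<or> (x, y) \<in> R \<or> (y, x) \<in> R" if "x \<in> P" "y \<in> P" for x y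
    using wo that Field unfolding R_def well_order_on_def linear_order_on_def total_on_def by blast
  have RP: "x \<in> P" if "(x, y) \<in> R" for x y
    using that Field unfolding R_def Field_def by blast
  \<comment> \<open>Containing all earlier values makes the stages a chain. The clause for
    \<open>g\<close> starts the recursion at the least element, and outside \<open>P\<close> the
    condition is vacuous because \<open>f\<close> lives on the whole type.\<close>
  define stage where "stage f x h \<longleftrightarrow> (x \<in> P \<longrightarrow> down_condensation P le r h \<and> bounded_rel P le h \<and>
      g \<subseteq> h \<and> (\<forall>y. (y, x) \<in> R \<longrightarrow> f y \<subseteq> h) \<and> x \<in> Domain h \<and> x \<in> Range h)"
    for f x h
  have "\<exists>f. \<forall>x. stage f x (f x)"
  \<comment> \<open>Extensions are only known to exist, so each value is chosen given the earlier
    ones; the first goal says that \<open>stage\<close> sees \<open>f\<close> only below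
    \<open>x\<close>.\<close>
  proof (rule dependent_wf_choice[OF \<open>wf R\<close>])
    show "stage f x h = stage f' x h" if "\<And>z. (z, x) \<in> R \<Longrightarrow> f z = f' z" for f f' x h
      using that unfolding stage_def by auto
  next
    fix x f assume IH: "\<And>y. (y, x) \<in> R \<Longrightarrow> stage f y (f y)"
    show "\<exists>h. stage f x h"
    proof (cases "x \<in> P")
      case False
      then show ?thesis unfolding stage_def by blast
    next
      case True
      define I where "I = {y. (y, x) \<in> R}"
      have st: "stage f y (f y)" "y \<in> P" if "y \<in> I" for y
        using IH RP that unfolding I_def by blast+
      \<comment> \<open>Successor and limit stages are treated alike by the union of all
        predecessors. With no predecessors that union is empty and lacks \<open>(r, r)\<close>, so
        \<open>g\<close> takes its place.\<close>
      have "\<exists>k. down_condensation P le r k \<and> bounded_rel P le k \<and> g \<subseteq> k \<and> (\<forall>y\<in>I. f y \<subseteq> k)"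
      proof (cases "I = {}")
        case True
        then show ?thesis using g bd by blast
      next
        case False
        have "|I| <o \<kappa>"
        proof -
          have "I = underS |P| x"
            unfolding I_def R_def underS_def by blast
          then have "|I| <o |P|"
            using card_of_underS[OF card_of_Card_order] True Field by metis
          then show ?thesis
            using card by (rule ordLess_ordIso_trans)
        qed
        then have "bounded_rel P le (\<Union>y\<in>I. f y)"
          using st unfolding stage_def by (intro bounded_rel_UN[OF dir tr]) blast+
        moreover have "down_condensation P le r (\<Union>y\<in>I. f y)"
        proof (rule down_condensation_Union)
          show "f ` I \<noteq> {}" using False by blast
          show "down_condensation P le r k" if "k \<in> f ` I" for k
            using that st unfolding stage_def by blast
          show "k \<subseteq> l \<or> l \<subseteq> k" if kl: "k \<in> f ` I" "l \<in> f ` I" for k l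
          proof -
            obtain y z where yz: "y \<in> I" "z \<in> I" "k = f y" "l = f z"
              using kl by blast
            then show ?thesis
              using totR[of y z] st[of y] st[of z] unfolding stage_def by blast
          qed
        qed
        moreover have "g \<subseteq> (\<Union>y\<in>I. f y)"
          using False st unfolding stage_def by blast
        ultimately show ?thesis by blast
      qed
      then obtain k where k: "down_condensation P le r k" "bounded_rel P le k" "g \<subseteq> k"
        "\<forall>y\<in>I. f y \<subseteq> k"
        by blast
      obtain h where "k \<subseteq> h" "x \<in> Domain h" "x \<in> Range h"
        "down_condensation P le r h" "bounded_rel P le h"
        using extend_both[OF po up root fresh emb k(1,2) True] by blast
      with k(3,4) have "stage f x h"
        unfolding stage_def I_def by blast
      then show ?thesis ..
    qed
  qed
  then obtain f where f: "\<And>x. stage f x (f x)"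
    by blast
  \<comment> \<open>This last union has \<open>\<kappa>\<close> members and need not be bounded;
    only the chain property is used.\<close>
  define h where "h = (\<Union>x\<in>P. f x)"
  have "P \<noteq> {}"
    using root unfolding is_root_def by blast
  have dh: "down_condensation P le r h"
    unfolding h_def
  proof (rule down_condensation_Union)
    show "f ` P \<noteq> {}" using \<open>P \<noteq> {}\<close> by blast
    show "down_condensation P le r k" if "k \<in> f ` P" for k
      using that f unfolding stage_def by blast
    show "k \<subseteq> l \<or> l \<subseteq> k" if kl: "k \<in> f ` P" "l \<in> f ` P" for k l
    proof -
      obtain y z where yz: "y \<in> P" "z \<in> P" "k = f y" "l = f z"
        using kl by blast
      then show ?thesis
        using totR[of y z] f[of y] f[of z] unfolding stage_def by blast
    qed
  qed
  have "g \<subseteq> h"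
    using \<open>P \<noteq> {}\<close> f unfolding h_def stage_def by blast
  moreover have "x \<in> Domain h" "x \<in> Range h" if "x \<in> P" for x
    using f[of x] that unfolding h_def stage_def by blast+
  moreover have "Domain h \<subseteq> P" "Range h \<subseteq> P"
    using down_condensationD(1)[OF dh] by blast+
  ultimately show thesis
    using that[OF _ dh] by blast
qed

section \<open>A condensation that does not preserve immediate successors of the root\<close>

theorem theorem6p1:
  fixes \<kappa> :: "'k rel" and P :: "'a set" and le :: "'a rel" and r :: 'a
  assumes "Cinfinite \<kappa>" and "regularCard \<kappa>"
    and "partial_order_on P le"
    and "directed_below \<kappa> P le"
    and "|P| =o \<kappa>"
    and "is_root P le r"
    and "\<forall>p\<in>P. Is P le r - under le p \<noteq> {}"
    and "\<exists>a\<^sub>0\<in>Is P le r. Is P le a\<^sub>0 \<noteq> {}"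
    and "\<forall>a\<in>P. \<forall>p\<in>P. \<exists>\<eta>\<in>Pc P le. dom \<eta> = under le a \<and> ran \<eta> \<subseteq> above le p"
  shows "\<not> reversible P le"
proof
  assume rev: "reversible P le"
  note po = assms(3) and dir = assms(4) and root = assms(6) and fresh = assms(7)
  have as: "antisym le" and refl: "\<And>x. x \<in> P \<Longrightarrow> (x, x) \<in> le"
    using po unfolding partial_order_on_def preorder_on_def refl_on_def by blast+
  have r: "r \<in> P" "\<And>x. x \<in> P \<Longrightarrow> (r, x) \<in> le"
    using root unfolding is_root_def by blast+
  have up: "\<exists>w\<in>P. (u, w) \<in> le \<and> (v, w) \<in> le" if "u \<in> P" "v \<in> P" for u v
  proof -
    have "|{u, v}| <o \<kappa>"
      using assms(1) by (intro Cfinite_ordLess_Cinfinite)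
        (simp_all add: cfinite_def Field_card_of card_of_card_order_on)
    moreover have "{u, v} \<subseteq> P"
      using that by blast
    ultimately have "\<exists>w\<in>P. \<forall>x\<in>{u, v}. (x, w) \<in> le"
      using dir[unfolded directed_below_def, rule_format, of "{u, v}"] by simp
    then show ?thesis by simp
  qed
  \<comment> \<open>The element \<open>a\<close> lies strictly between \<open>r\<close> and
    \<open>b\<close>, so \<open>b\<close> is not an immediate successor of the root.\<close>
  obtain a b where ab: "a \<in> Is P le r" "b \<in> Is P le a"
    using assms(8) by blast
  have b: "b \<in> P" "(a, b) \<in> le" "b \<noteq> a"
    using ab(2) unfolding Is_def strictly_below_def by blast+
  have "b \<noteq> r"
    using b IsD(1-3)[OF ab(1)] antisymD[OF as] by blast
  have "Domain {(r, r)} \<subseteq> under le r" "Range {(r, r)} \<subseteq> under le r"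
    using refl[OF r(1)] unfolding under_def by blast+
  then have "bounded_rel P le {(r, r)}"
    using r(1) unfolding bounded_rel_def by blast
  moreover have "down_condensation P le r {(r, r)}"
    using r antisymD[OF as] refl po
    unfolding down_condensation_def under_def partial_order_on_def preorder_on_def by blast
  \<comment> \<open>Requesting \<open>b\<close> in the range of \<open>{(r, r)}\<close> yields the
    bad pair: an immediate successor \<open>x\<close> of the root, not necessarily \<open>a\<close>,
    is sent to \<open>b\<close>.\<close>
  ultimately obtain x where x: "x \<in> Is P le r"
    "down_condensation P le r {(x, b), (r, r)}" "bounded_rel P le {(x, b), (r, r)}"
    using extend_range[OF po up root fresh, of "{(r, r)}" b] b(1) \<open>b \<noteq> r\<close> by blast
  obtain h where h: "{(x, b), (r, r)} \<subseteq> h" "down_condensation P le r h" "Domain h = P" "Range h = P"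
    using exhaust_by_extension[OF po dir assms(5) root fresh assms(9) up x(2,3)] by blast
  obtain f where f: "condensation_on P le f" "\<And>x y. (x, y) \<in> h \<Longrightarrow> f x = y"
    using total_down_condensation[OF h(2-4)] by blast
  have fx: "f x = b" "f r = r"
    using f(2) h(1) by blast+
  have aut: "automorphism_on P le f"
    using rev f(1) unfolding reversible_def by blast
  then have "f ` P = P"
    unfolding automorphism_on_def bij_betw_def by simp
  have iff: "(u, v) \<in> le \<longleftrightarrow> (f u, f v) \<in> le" if "u \<in> P" "v \<in> P" for u v
    using aut that unfolding automorphism_on_def by simp
  note xD = IsD[OF x(1)]
  \<comment> \<open>An automorphism reflects \<open>a\<close> below \<open>b\<close> to
    \<open>z\<close> below \<open>x\<close>. Then \<open>z\<close> is \<open>r\<close> or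
    \<open>x\<close>, so \<open>a\<close> would be \<open>r\<close> or \<open>b\<close>.\<close>
  obtain z where z: "z \<in> P" "f z = a"
    using IsD(1)[OF ab(1)] \<open>f ` P = P\<close> by (metis imageE)
  have "(z, x) \<in> le"
    using iff[OF z(1) xD(1)] z(2) fx(1) b(2) by simp
  then have "z = r \<or> z = x"
    by (rule xD(4)[OF root z(1)])
  then show False
    using z(2) fx b(3) IsD(3)[OF ab(1)] by blast
qed

end
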